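(* Let $d\ge2$ and $[d]=\{1,\dots,d\}$. Let $\boldsymbol I=(I_1,\dots,I_d)$ be a $\{0,1\}^d$-valued random vector with $\mathbb{P}(I_m=1)=\pi_m\in(0,1)$ for $m\in[d]$. For each $m\in[d]$ let $(F_{m,[0]},F_{m,[1]})$ be a $\pi_m$-calibrated pair of cdfs supported on $[0,1]$, and let $U_{m,[0]}\sim F_{m,[0]}$ and $U_{m,[1]}\sim F_{m,[1]}$. Assume the random variables $\{U_{m,[0]},U_{m,[1]}:m\in[d]\}$ are independent and that this collection is independent of $\boldsymbol I$. Define $$U_m=(1-I_m)U_{m,[0]}+I_mU_{m,[1]},\quad m\in[d],\qquad \boldsymbol U=(U_1,\dots,U_d),$$ $$g_m(u)=\pi_m\left(F_{m,[1]}(u)-F_{m,[0]}(u)\right),\quad u\in[0,1],\qquad \theta_S=\mathbb{E}\left[\prod_{m\in S}\frac{I_m-\pi_m}{\pi_m}\right],\quad S\subseteq[d],\ |S|\ge2.$$ Then $\boldsymbol U$ has copula $C$ satisfying, for all $\boldsymbol u=(u_1,\dots,u_d)\in[0,1]^d$, $$C(\boldsymbol u)=\prod_{m=1}^du_m+\sum_{\substack{S\subseteq[d]\\|S|\ge2}}\theta_S\left(\prod_{m\notin S}u_m\right)\left(\prod_{m\in S}g_m(u_m)\right).$$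
   Context: For $\pi\in(0,1)$, two cdfs $F_{[0]},F_{[1]}$ supported on $[0,1]$ form a $\pi$-calibrated pair if $(1-\pi)F_{[0]}(u)+\pi F_{[1]}(u)=u$ for all $u\in[0,1]$. A $d$-copula is a distribution function on $[0,1]^d$ with uniform univariate margins; the copula of a random vector with uniform $(0,1)$ margins is its joint cdf restricted to $[0,1]^d$. *)

theory Defs
  imports "HOL-Probability.Probability"
begin

definition unit_cdf :: "(real \<Rightarrow> real) \<Rightarrow> bool" where
  "unit_cdf F \<longleftrightarrow> (\<exists>N. real_distribution N \<and> measure N {0..1} = 1 \<and> cdf N = F)"

definition calibrated_pair :: "real \<Rightarrow> (real \<Rightarrow> real) \<Rightarrow> (real \<Rightarrow> real) \<Rightarrow> bool" where
  "calibrated_pair p F0 F1 \<longleftrightarrow>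
     unit_cdf F0 \<and> unit_cdf F1 \<and> (\<forall>u\<in>{0..1}. (1 - p) * F0 u + p * F1 u = u)"

definition has_cdf :: "'w measure \<Rightarrow> ('w \<Rightarrow> real) \<Rightarrow> (real \<Rightarrow> real) \<Rightarrow> bool" where
  "has_cdf M X F \<longleftrightarrow> X \<in> borel_measurable M \<and> cdf (distr M borel X) = F"

definition uniform01 :: "'w measure \<Rightarrow> ('w \<Rightarrow> real) \<Rightarrow> bool" where
  "uniform01 M X \<longleftrightarrow>
     X \<in> borel_measurable M \<and> distr M borel X = uniform_measure lborel {0<..<1}"

text \<open>Points of \<open>\<real>\<^sup>d\<close> are functions on the index set \<open>{1..d}\<close>, extended by
  \<open>undefined\<close> outside it; functions on the unit cube are likewise extensional on the cube.\<close>

definition unit_cube :: "nat \<Rightarrow> (nat \<Rightarrow> real) set" where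
  "unit_cube d = (\<Pi>\<^sub>E m\<in>{1..d}. {0..1})"

definition joint_cdf ::
  "'w measure \<Rightarrow> nat \<Rightarrow> (nat \<Rightarrow> 'w \<Rightarrow> real) \<Rightarrow> (nat \<Rightarrow> real) \<Rightarrow> real" where
  "joint_cdf M d X u = measure M {\<omega> \<in> space M. \<forall>m\<in>{1..d}. X m \<omega> \<le> u m}"

definition is_copula :: "nat \<Rightarrow> ((nat \<Rightarrow> real) \<Rightarrow> real) \<Rightarrow> bool" where
  "is_copula d C \<longleftrightarrow>
     (\<exists>N. prob_space N \<and> sets N = sets (\<Pi>\<^sub>M m\<in>{1..d}. (borel :: real measure)) \<and>
          (\<forall>m\<in>{1..d}. uniform01 N (\<lambda>x. x m)) \<and>
          C = restrict (joint_cdf N d (\<lambda>m x. x m)) (unit_cube d))"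

definition has_copula ::
  "'w measure \<Rightarrow> nat \<Rightarrow> (nat \<Rightarrow> 'w \<Rightarrow> real) \<Rightarrow> ((nat \<Rightarrow> real) \<Rightarrow> real) \<Rightarrow> bool" where
  "has_copula M d X C \<longleftrightarrow>
     (\<forall>m\<in>{1..d}. uniform01 M (X m)) \<and> C = restrict (joint_cdf M d X) (unit_cube d)"

text \<open>The library constant \<open>indep_var\<close> only relates random variables of the same type; this is
  the same notion (independence of the generated \<open>\<sigma>\<close>-algebras) for two different types.\<close>

definition indep_rv ::
  "'w measure \<Rightarrow> 'a measure \<Rightarrow> ('w \<Rightarrow> 'a) \<Rightarrow> 'b measure \<Rightarrow> ('w \<Rightarrow> 'b) \<Rightarrow> bool" where
  "indep_rv M A X B Y \<longleftrightarrow>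
     X \<in> measurable M A \<and> Y \<in> measurable M B \<and>
     prob_space.indep_set M {X -` E \<inter> space M | E. E \<in> sets A} {Y -` E \<inter> space M | E. E \<in> sets B}"

definition select_var ::
  "(nat \<Rightarrow> 'w \<Rightarrow> nat) \<Rightarrow> (nat \<Rightarrow> nat \<Rightarrow> 'w \<Rightarrow> real) \<Rightarrow> nat \<Rightarrow> 'w \<Rightarrow> real" where
  "select_var I V m \<omega> = (1 - real (I m \<omega>)) * V m 0 \<omega> + real (I m \<omega>) * V m 1 \<omega>"

definition g_fun ::
  "(nat \<Rightarrow> real) \<Rightarrow> (nat \<Rightarrow> nat \<Rightarrow> real \<Rightarrow> real) \<Rightarrow> nat \<Rightarrow> real \<Rightarrow> real" where
  "g_fun p F m u = p m * (F m 1 u - F m 0 u)"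

definition theta ::
  "'w measure \<Rightarrow> (nat \<Rightarrow> real) \<Rightarrow> (nat \<Rightarrow> 'w \<Rightarrow> nat) \<Rightarrow> nat set \<Rightarrow> real" where
  "theta M p I S = (LINT \<omega>|M. (\<Prod>m\<in>S. (real (I m \<omega>) - p m) / p m))"

end

theory Submission
  imports Defs
begin

text \<open>Conditionally on \<open>I\<close>, the variables \<open>U m\<close> are independent with cdfs \<open>F m (I m)\<close>, so the joint
  cdf of \<open>U\<close> at \<open>u\<close> is the expectation of \<open>\<Prod>m. F m (I m) (u m)\<close>. Calibration turns each factor into
  \<open>u m + g m (u m) * ((I m - p m) / p m)\<close>. Expanding the product over subsets \<open>S\<close> gives the formula;
  the terms with \<open>card S = 1\<close> vanish because \<open>I m - p m\<close> is centred, and the case of a single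
  index gives uniformity of the margins.\<close>

section \<open>Uniform laws and copulas from probabilities of lower orthants\<close>

text \<open>A law on the real line is determined by its cdf. The values 0 at 0 and 1 at 1 force, by
  monotonicity, the value 0 further left and 1 further right, so the unit interval suffices.\<close>

lemma uniform01_if_cdf:
  assumes "prob_space M" and X: "X \<in> borel_measurable M"
    and cdf: "\<And>x. x \<in> {0..1} \<Longrightarrow> measure M {\<omega> \<in> space M. X \<omega> \<le> x} = x"
  shows "uniform01 M X"
proof -
  interpret prob_space M by fact
  let ?D = "distr M borel X" and ?L = "uniform_measure lborel {0<..<1::real}"
  interpret D: real_distribution ?D
    using X by (rule real_distribution_distr)
  interpret L: prob_space ?L
    by (rule prob_space_uniform_measure) auto
  interpret L: real_distribution ?L
    by unfold_locales auto
  have D_cdf: "cdf ?D x = x" if "x \<in> {0..1}" for x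
    using cdf[OF that] X
    by (simp add: cdf_def measure_distr vimage_def Int_def conj_commute)
  have L_cdf: "cdf ?L x = measure lborel ({0<..<1} \<inter> {..x})" for x
    by (simp add: cdf_def)
  have "cdf ?D x = cdf ?L x" for x
  proof -
    consider "x < 0" | "x \<in> {0..1}" | "x > 1" by fastforce
    then show ?thesis
    proof cases
      case 1
      then have "cdf ?D x \<le> cdf ?D 0" by (intro D.cdf_nondecreasing) simp
      with D_cdf[of 0] have "cdf ?D x = 0" using D.cdf_nonneg[of x] by simp
      moreover have "{0<..<1} \<inter> {..x} = {}" using 1 by auto
      ultimately show ?thesis by (simp add: L_cdf)
    next
      case 2
      \<comment> \<open>The open interval lacks its right end, so \<open>x = 1\<close> needs its own
        form; at \<open>x = 0\<close> both sides are empty.\<close>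
      then have "{0<..<1} \<inter> {..x} = (if x = 1 then {0<..<1} else {0<..x})" by auto
      with 2 show ?thesis by (simp add: L_cdf D_cdf)
    next
      case 3
      then have "cdf ?D 1 \<le> cdf ?D x" by (intro D.cdf_nondecreasing) simp
      with D_cdf[of 1] have "cdf ?D x = 1" using D.cdf_bounded_prob[of x] by simp
      moreover have "{0<..<1} \<inter> {..x} = {0<..<1}" using 3 by auto
      ultimately show ?thesis by (simp add: L_cdf)
    qed
  qed
  then have "?D = ?L"
    by (intro cdf_unique D.real_distribution_axioms L.real_distribution_axioms) auto
  with X show ?thesis by (simp add: uniform01_def)
qed

text \<open>The measure required by \<open>is_copula\<close> is the image of \<open>M\<close> under
  the random vector. Its coordinate projections have the laws of the \<open>X m\<close>, and
  orthants pull back to the events in \<open>joint_cdf M d X\<close>. The vector is restricted to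
  \<open>{1..d}\<close> because points of the product space are extensional.\<close>

lemma is_copula_joint_cdf:
  assumes "prob_space M" and unif: "\<And>m. m \<in> {1..d} \<Longrightarrow> uniform01 M (X m)"
  shows "is_copula d (restrict (joint_cdf M d X) (unit_cube d))"
proof -
  interpret prob_space M by fact
  let ?P = "\<Pi>\<^sub>M m\<in>{1..d}. (borel :: real measure)"
  let ?X = "\<lambda>\<omega>. \<lambda>m\<in>{1..d}. X m \<omega>"
  have X: "X m \<in> borel_measurable M" if "m \<in> {1..d}" for m
    using unif[OF that] by (simp add: uniform01_def)
  have meas: "?X \<in> measurable M ?P"
    using X by (intro measurable_restrict)
  have "uniform01 (distr M ?P ?X) (\<lambda>x. x m)" if m: "m \<in> {1..d}" for m
  proof -
    have "distr (distr M ?P ?X) borel (\<lambda>x. x m) = distr M borel ((\<lambda>x. x m) \<circ> ?X)"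
      using m meas by (intro distr_distr measurable_component_singleton)
    also have "(\<lambda>x. x m) \<circ> ?X = X m"
      using m by (auto simp: fun_eq_iff)
    finally have "distr (distr M ?P ?X) borel (\<lambda>x. x m) = uniform_measure lborel {0<..<1}"
      using unif[OF m] by (simp only: uniform01_def)
    then show ?thesis
      unfolding uniform01_def measurable_distr_eq1
      using measurable_component_singleton[OF m, of "\<lambda>_. borel"] by blast
  qed
  moreover have "joint_cdf (distr M ?P ?X) d (\<lambda>m x. x m) u = joint_cdf M d X u" for u
  proof -
    have "{x \<in> space ?P. \<forall>m\<in>{1..d}. x m \<le> u m} \<in> sets ?P"
      by measurable
    moreover have "?X -` {x \<in> space ?P. \<forall>m\<in>{1..d}. x m \<le> u m} \<inter> space M
        = {\<omega> \<in> space M. \<forall>m\<in>{1..d}. X m \<omega> \<le> u m}"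
      by (auto simp: space_PiM)
    ultimately show ?thesis
      using meas by (simp add: joint_cdf_def measure_distr)
  qed
  ultimately show ?thesis
    unfolding is_copula_def using prob_space_distr[OF meas]
    by (intro exI[of _ "distr M ?P ?X"]) (auto simp: fun_eq_iff restrict_def)
qed

section \<open>The calibrated mixture over a finite index set, later \<open>{1..d}\<close>\<close>

locale calibrated_mixture = prob_space M for M :: "'w measure" +
  fixes J :: "nat set" and I :: "nat \<Rightarrow> 'w \<Rightarrow> nat" and p :: "nat \<Rightarrow> real"
    and F :: "nat \<Rightarrow> nat \<Rightarrow> real \<Rightarrow> real" and V :: "nat \<Rightarrow> nat \<Rightarrow> 'w \<Rightarrow> real"
  assumes finite_J: "finite J"
    and I_meas: "\<And>m. m \<in> J \<Longrightarrow> I m \<in> measurable M (count_space {0, 1})"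
    and p_pos: "\<And>m. m \<in> J \<Longrightarrow> 0 < p m"
    and prob_I: "\<And>m. m \<in> J \<Longrightarrow> prob {\<omega> \<in> space M. I m \<omega> = 1} = p m"
    and calibrated: "\<And>m. m \<in> J \<Longrightarrow> calibrated_pair (p m) (F m 0) (F m 1)"
    and V_cdf: "\<And>m b. m \<in> J \<Longrightarrow> b \<in> {0, 1} \<Longrightarrow> has_cdf M (V m b) (F m b)"
    and indep_V: "indep_vars (\<lambda>_. borel) (\<lambda>(m, b). V m b) (J \<times> {0, 1})"
    and indep_I_V: "indep_rv M
           (\<Pi>\<^sub>M m\<in>J. count_space {0, 1}) (\<lambda>\<omega>. \<lambda>m\<in>J. I m \<omega>)
           (\<Pi>\<^sub>M i\<in>J \<times> {0, 1}. borel) (\<lambda>\<omega>. \<lambda>i\<in>J \<times> {0, 1}. V (fst i) (snd i) \<omega>)"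
begin

lemma I_cases: "m \<in> J \<Longrightarrow> \<omega> \<in> space M \<Longrightarrow> I m \<omega> = 0 \<or> I m \<omega> = 1"
  using measurable_space[OF I_meas] by auto

lemma real_I_measurable: "m \<in> J \<Longrightarrow> (\<lambda>\<omega>. real (I m \<omega>)) \<in> borel_measurable M"
  using measurable_compose[OF I_meas, of m real borel] by simp

lemma V_measurable: "m \<in> J \<Longrightarrow> b \<in> {0, 1} \<Longrightarrow> V m b \<in> borel_measurable M"
  using V_cdf unfolding has_cdf_def by blast

lemma select_var_measurable: "m \<in> J \<Longrightarrow> select_var I V m \<in> borel_measurable M"
  unfolding select_var_def[abs_def]
  using V_measurable real_I_measurable by (intro borel_measurable_add borel_measurable_times borel_measurable_diff) auto

lemma select_var_eq: "m \<in> J \<Longrightarrow> \<omega> \<in> space M \<Longrightarrow> select_var I V m \<omega> = V m (I m \<omega>) \<omega>"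
  using I_cases[of m \<omega>] by (auto simp: select_var_def)

lemma prob_V_le: "m \<in> J \<Longrightarrow> b \<in> {0, 1} \<Longrightarrow> prob (V m b -` {..x} \<inter> space M) = F m b x"
  using V_cdf[of m b] by (auto simp: has_cdf_def cdf_def measure_distr fun_eq_iff)

section \<open>Conditioning on the vector of indicators\<close>

text \<open>Once the indicator vector is fixed to \<open>c\<close>, the other condition concerns
  \<open>V\<close> alone. Independence of \<open>I\<close> from \<open>V\<close> splits off the
  first factor, and mutual independence of the \<open>V m b\<close> factorizes the second.\<close>

lemma prob_I_and_V:
  assumes c: "c \<in> J \<rightarrow>\<^sub>E {0, 1}" and A: "A \<subseteq> J" "A \<noteq> {}"
  shows "prob {\<omega> \<in> space M. (\<lambda>m\<in>J. I m \<omega>) = c \<and> (\<forall>m\<in>A. V m (c m) \<omega> \<le> u m)}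
       = prob {\<omega> \<in> space M. (\<lambda>m\<in>J. I m \<omega>) = c} * (\<Prod>m\<in>A. F m (c m) (u m))"
proof -
  let ?P = "\<Pi>\<^sub>M m\<in>J. count_space {0, 1::nat}"
  let ?Q = "\<Pi>\<^sub>M i\<in>J \<times> {0, 1::nat}. (borel :: real measure)"
  let ?I = "\<lambda>\<omega>. \<lambda>m\<in>J. I m \<omega>"
  let ?V = "\<lambda>\<omega>. \<lambda>i\<in>J \<times> {0, 1}. V (fst i) (snd i) \<omega>"
  let ?G = "{y \<in> space ?Q. \<forall>m\<in>A. y (m, c m) \<le> u m}"
  have finA: "finite A" using A finite_J finite_subset by blast
  have cA: "(m, c m) \<in> J \<times> {0, 1}" if "m \<in> A" for m
    using that A PiE_mem[OF c] by blast
  \<comment> \<open>A singleton is a box of singletons because \<open>c\<close> is extensional; this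
    makes it measurable in the product.\<close>
  have "{c} = (\<Pi>\<^sub>E m\<in>J. {c m})"
    using c by (subst PiE_singleton) (auto simp: PiE_iff)
  also have "\<dots> \<in> sets ?P"
    using c by (intro sets_PiM_I_finite finite_J) auto
  finally have E: "{c} \<in> sets ?P" .
  have G: "?G \<in> sets ?Q"
    using cA finA by measurable
  have "prob ((?I -` {c} \<inter> space M) \<inter> (?V -` ?G \<inter> space M))
      = prob (?I -` {c} \<inter> space M) * prob (?V -` ?G \<inter> space M)"
    using indep_I_V E G unfolding indep_rv_def by (intro indep_setD) blast+
  moreover have "?I -` {c} \<inter> space M = {\<omega> \<in> space M. ?I \<omega> = c}"
    by auto
  moreover have V_vimage: "?V -` ?G \<inter> space M = {\<omega> \<in> space M. \<forall>m\<in>A. V m (c m) \<omega> \<le> u m}"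
    using cA by (auto simp: space_PiM)
  moreover have "prob {\<omega> \<in> space M. \<forall>m\<in>A. V m (c m) \<omega> \<le> u m} = (\<Prod>m\<in>A. F m (c m) (u m))"
  proof -
    let ?h = "\<lambda>m. (m, c m)"
    \<comment> \<open>The injection \<open>?h\<close> picks from each pair \<open>V m 0\<close>,
      \<open>V m 1\<close> the variable that \<open>c\<close> selects, so the product over its image
      reindexes to \<open>A\<close>.\<close>
    have h: "?h ` A \<subseteq> J \<times> {0, 1}"
      using cA by blast
    have "{\<omega> \<in> space M. \<forall>m\<in>A. V m (c m) \<omega> \<le> u m}
        = (\<Inter>i\<in>?h ` A. (case i of (m, b) \<Rightarrow> V m b) -` {..u (fst i)} \<inter> space M)"
      using A by auto
    also have "prob \<dots> = (\<Prod>i\<in>?h ` A. prob ((case i of (m, b) \<Rightarrow> V m b) -` {..u (fst i)} \<inter> space M))"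
      using h A finA by (intro indep_varsD[OF indep_V]) auto
    also have "\<dots> = (\<Prod>m\<in>A. prob (V m (c m) -` {..u m} \<inter> space M))"
      by (subst prod.reindex) (auto simp: inj_on_def)
    also have "\<dots> = (\<Prod>m\<in>A. F m (c m) (u m))"
      using cA by (intro prod.cong refl prob_V_le) blast+
    finally show ?thesis .
  qed
  moreover have "{\<omega> \<in> space M. ?I \<omega> = c \<and> (\<forall>m\<in>A. V m (c m) \<omega> \<le> u m)}
      = (?I -` {c} \<inter> space M) \<inter> (?V -` ?G \<inter> space M)"
    unfolding V_vimage by auto
  ultimately show ?thesis by simp
qed

lemma I_vector_sets:
  assumes "c \<in> J \<rightarrow>\<^sub>E {0, 1}"
  shows "{\<omega> \<in> space M. (\<lambda>m\<in>J. I m \<omega>) = c} \<in> events"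
proof -
  have "(\<lambda>m\<in>J. I m \<omega>) = c \<longleftrightarrow> (\<forall>m\<in>J. real (I m \<omega>) = real (c m))" for \<omega>
    by (metis PiE_restrict assms of_nat_eq_iff restrict_apply' restrict_ext)
  then have "{\<omega> \<in> space M. (\<lambda>m\<in>J. I m \<omega>) = c} = {\<omega> \<in> space M. \<forall>m\<in>J. real (I m \<omega>) = real (c m)}"
    by simp
  also have "\<dots> \<in> events"
    by (intro sets.sets_Collect_finite_All finite_J borel_measurable_eq real_I_measurable
      borel_measurable_const)
  finally show ?thesis .
qed

text \<open>This is the law of total probability over the finitely many values \<open>c\<close> of
  the indicator vector.\<close>

lemma prob_select_var_le:
  assumes A: "A \<subseteq> J" "A \<noteq> {}"
  shows "prob {\<omega> \<in> space M. \<forall>m\<in>A. select_var I V m \<omega> \<le> u m}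
       = expectation (\<lambda>\<omega>. \<Prod>m\<in>A. F m (I m \<omega>) (u m))"
proof -
  let ?B = "J \<rightarrow>\<^sub>E {0, 1::nat}"
  let ?I = "\<lambda>\<omega>. \<lambda>m\<in>J. I m \<omega>"
  have finA: "finite A" using A finite_J finite_subset by blast
  have finB: "finite ?B" using finite_J by (intro finite_PiE) auto
  have IB: "?I \<omega> \<in> ?B" if "\<omega> \<in> space M" for \<omega>
    using I_cases that by auto
  have sets: "{\<omega> \<in> space M. ?I \<omega> = c \<and> (\<forall>m\<in>A. V m (c m) \<omega> \<le> u m)} \<in> events"
    if c: "c \<in> ?B" for c
  proof -
    have "V m (c m) \<in> borel_measurable M" if "m \<in> A" for m
      using that A PiE_mem[OF c, of m] by (intro V_measurable) auto
    then have "{\<omega> \<in> space M. \<forall>m\<in>A. V m (c m) \<omega> \<le> u m} \<in> events"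
      using finA by measurable
    from sets.Int[OF I_vector_sets[OF c] this] show ?thesis
      by (rule back_subst[of "\<lambda>X. X \<in> events"]) auto
  qed
  have "{\<omega> \<in> space M. \<forall>m\<in>A. select_var I V m \<omega> \<le> u m}
      = (\<Union>c\<in>?B. {\<omega> \<in> space M. ?I \<omega> = c \<and> (\<forall>m\<in>A. V m (c m) \<omega> \<le> u m)})"
    (is "?L = ?R")
  proof (intro set_eqI)
    fix \<omega>
    \<comment> \<open>For a given point of \<open>space M\<close>, the only possible
      \<open>c\<close> is the value of \<open>?I\<close> there, and it lies in
      \<open>?B\<close>.\<close>
    have "\<omega> \<in> ?R \<longleftrightarrow> \<omega> \<in> space M \<and> (\<forall>m\<in>A. V m (?I \<omega> m) \<omega> \<le> u m)"
      using IB[of \<omega>] by blast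
    also have "\<dots> \<longleftrightarrow> \<omega> \<in> ?L"
      using A select_var_eq by (auto simp: subset_iff)
    finally show "\<omega> \<in> ?L \<longleftrightarrow> \<omega> \<in> ?R" by simp
  qed
  then have "prob {\<omega> \<in> space M. \<forall>m\<in>A. select_var I V m \<omega> \<le> u m}
      = (\<Sum>c\<in>?B. prob {\<omega> \<in> space M. ?I \<omega> = c \<and> (\<forall>m\<in>A. V m (c m) \<omega> \<le> u m)})"
    using sets finB by (simp only:) (intro finite_measure_finite_Union; auto simp: disjoint_family_on_def)
  also have "\<dots> = (\<Sum>c\<in>?B. prob {\<omega> \<in> space M. ?I \<omega> = c} * (\<Prod>m\<in>A. F m (c m) (u m)))"
    using A by (intro sum.cong prob_I_and_V) auto
  \<comment> \<open>Each probability becomes the expectation of an indicator; pointwise only the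
    summand with \<open>c\<close> equal to the value of \<open>?I\<close> survives.\<close>
  also have "\<dots> = expectation (\<lambda>\<omega>. \<Sum>c\<in>?B. indicator {\<omega> \<in> space M. ?I \<omega> = c} \<omega> * (\<Prod>m\<in>A. F m (c m) (u m)))"
    using I_vector_sets by (subst Bochner_Integration.integral_sum) (auto simp: emeasure_eq_measure)
  also have "\<dots> = expectation (\<lambda>\<omega>. \<Prod>m\<in>A. F m (I m \<omega>) (u m))"
  proof (rule Bochner_Integration.integral_cong[OF refl])
    fix \<omega> assume \<omega>: "\<omega> \<in> space M"
    have "(\<Sum>c\<in>?B. indicator {\<omega> \<in> space M. ?I \<omega> = c} \<omega> * (\<Prod>m\<in>A. F m (c m) (u m)))
        = (\<Sum>c\<in>?B. if ?I \<omega> = c then \<Prod>m\<in>A. F m (c m) (u m) else 0)"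
      using \<omega> by (intro sum.cong) (auto simp: indicator_def)
    also have "\<dots> = (\<Prod>m\<in>A. F m (?I \<omega> m) (u m))"
      using IB[OF \<omega>] finB by (simp only: sum.delta') simp
    also have "\<dots> = (\<Prod>m\<in>A. F m (I m \<omega>) (u m))"
      using A by (intro prod.cong) auto
    finally show "(\<Sum>c\<in>?B. indicator {\<omega> \<in> space M. ?I \<omega> = c} \<omega> * (\<Prod>m\<in>A. F m (c m) (u m)))
        = (\<Prod>m\<in>A. F m (I m \<omega>) (u m))" .
  qed
  finally show ?thesis .
qed

section \<open>Expansion over subsets of indices\<close>

text \<open>Calibration gives \<open>F m 0 x = x - g\<close> and
  \<open>F m 1 x = x + (1 - p m) / p m * g\<close> with \<open>g = g_fun p F m x\<close>. The
  coefficients \<open>-1\<close> and \<open>(1 - p m) / p m\<close> are the values of the normalized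
  indicator at 0 and 1.\<close>

lemma conditional_cdf_eq:
  assumes m: "m \<in> J" and \<omega>: "\<omega> \<in> space M" and x: "x \<in> {0..1}"
  shows "F m (I m \<omega>) x = (real (I m \<omega>) - p m) / p m * g_fun p F m x + x"
proof -
  have "(1 - p m) * F m 0 x + p m * F m 1 x = x"
    using calibrated[OF m] x by (simp add: calibrated_pair_def)
  then have "F m 0 x = x - p m * (F m 1 x - F m 0 x)"
    and "F m 1 x = (1 - p m) * (F m 1 x - F m 0 x) + x"
    by (simp_all add: algebra_simps)
  then show ?thesis
    using I_cases[OF m \<omega>] p_pos[OF m] by (auto simp: g_fun_def)
qed

text \<open>Each factor is bounded since \<open>I m\<close> takes only the values 0 and 1.
  Integrability permits exchanging expectation with the sum over subsets.\<close>

lemma integrable_prod_I: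
  assumes "S \<subseteq> J"
  shows "integrable M (\<lambda>\<omega>. \<Prod>m\<in>S. (real (I m \<omega>) - p m) / p m)"
proof (rule integrable_const_bound)
  show "(\<lambda>\<omega>. \<Prod>m\<in>S. (real (I m \<omega>) - p m) / p m) \<in> borel_measurable M"
    using assms real_I_measurable
    by (intro borel_measurable_prod borel_measurable_divide borel_measurable_diff) auto
  show "AE \<omega> in M. norm (\<Prod>m\<in>S. (real (I m \<omega>) - p m) / p m) \<le> (\<Prod>m\<in>S. (1 + \<bar>p m\<bar>) / \<bar>p m\<bar>)"
  proof (rule AE_I2)
    fix \<omega> assume "\<omega> \<in> space M"
    then have "\<bar>real (I m \<omega>) - p m\<bar> \<le> 1 + \<bar>p m\<bar>" if "m \<in> S" for m
      using I_cases[of m \<omega>] that assms by fastforce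
    then show "norm (\<Prod>m\<in>S. (real (I m \<omega>) - p m) / p m) \<le> (\<Prod>m\<in>S. (1 + \<bar>p m\<bar>) / \<bar>p m\<bar>)"
      by (auto simp: abs_prod intro!: prod_mono divide_right_mono)
  qed
qed

lemma theta_empty: "theta M p I {} = 1"
  by (simp add: theta_def prob_space)

text \<open>On \<open>space M\<close>, \<open>I m\<close> is the indicator of an event of
  probability \<open>p m\<close>, so subtracting \<open>p m\<close> centres it.\<close>

lemma theta_singleton:
  assumes m: "m \<in> J"
  shows "theta M p I {m} = 0"
proof -
  have ev: "{\<omega> \<in> space M. I m \<omega> = 1} \<in> events"
    using measurable_sets[OF I_meas[OF m], of "{1}"]
    by (simp add: vimage_def Int_def conj_commute)
  have "expectation (\<lambda>\<omega>. (real (I m \<omega>) - p m) / p m)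
      = expectation (\<lambda>\<omega>. (indicator {\<omega> \<in> space M. I m \<omega> = 1} \<omega> - p m) / p m)"
    using I_cases[OF m] by (intro Bochner_Integration.integral_cong) (force simp: indicator_def)+
  also have "\<dots> = 0"
    using ev prob_I[OF m] by (simp add: prob_space emeasure_eq_measure)
  finally show ?thesis by (simp add: theta_def)
qed

text \<open>A general nonempty \<open>A\<close> serves two purposes: \<open>A = J\<close> gives the
  joint cdf and \<open>A = {m}\<close> the margins.\<close>

lemma prob_select_var_le_formula:
  assumes A: "A \<subseteq> J" "A \<noteq> {}" and u: "\<And>m. m \<in> A \<Longrightarrow> u m \<in> {0..1}"
  shows "prob {\<omega> \<in> space M. \<forall>m\<in>A. select_var I V m \<omega> \<le> u m} = (\<Prod>m\<in>A. u m) +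
     (\<Sum>S | S \<subseteq> A \<and> card S \<ge> 2.
        theta M p I S * (\<Prod>m\<in>A - S. u m) * (\<Prod>m\<in>S. g_fun p F m (u m)))"
proof -
  let ?Y = "\<lambda>m \<omega>. (real (I m \<omega>) - p m) / p m"
  let ?g = "\<lambda>m. g_fun p F m (u m)"
  let ?t = "\<lambda>S. theta M p I S * (\<Prod>m\<in>A - S. u m) * (\<Prod>m\<in>S. ?g m)"
  have finA: "finite A" using A finite_J finite_subset by blast
  have "expectation (\<lambda>\<omega>. \<Prod>m\<in>A. F m (I m \<omega>) (u m))
      = expectation (\<lambda>\<omega>. \<Prod>m\<in>A. ?Y m \<omega> * ?g m + u m)"
    using A u by (intro Bochner_Integration.integral_cong prod.cong conditional_cdf_eq) auto
  also have "\<dots> = expectation (\<lambda>\<omega>. \<Sum>S\<in>Pow A. (\<Prod>m\<in>S. ?Y m \<omega>) * ((\<Prod>m\<in>A - S. u m) * (\<Prod>m\<in>S. ?g m)))"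
    \<comment> \<open>In the expanded product, \<open>S\<close> collects the indices whose factor
      contributes its \<open>?Y\<close> term; those in \<open>A - S\<close> contribute
      \<open>u m\<close>.\<close>
    by (simp only: prod_add[OF finA] prod.distrib mult_ac)
  also have "\<dots> = (\<Sum>S\<in>Pow A. expectation (\<lambda>\<omega>. (\<Prod>m\<in>S. ?Y m \<omega>) * ((\<Prod>m\<in>A - S. u m) * (\<Prod>m\<in>S. ?g m))))"
    using A by (intro Bochner_Integration.integral_sum integrable_mult_left integrable_prod_I) auto
  also have "\<dots> = (\<Sum>S\<in>Pow A. ?t S)"
    unfolding theta_def mult.assoc
    using A by (intro sum.cong refl integral_mult_left integrable_prod_I) auto
  \<comment> \<open>The empty set is kept: as \<open>theta\<close> is 1 there, it yields the leading
    product of the \<open>u m\<close>. Only singletons are dropped.\<close>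
  also have "\<dots> = (\<Sum>S\<in>insert {} {S. S \<subseteq> A \<and> card S \<ge> 2}. ?t S)"
  proof (rule sum.mono_neutral_right)
    show "\<forall>S\<in>Pow A - insert {} {S. S \<subseteq> A \<and> card S \<ge> 2}. ?t S = 0"
    proof
      fix S assume S: "S \<in> Pow A - insert {} {S. S \<subseteq> A \<and> card S \<ge> 2}"
      \<comment> \<open>Infinite sets also have \<open>card\<close> 0, so finiteness of
        \<open>A\<close> is what turns nonemptiness into a nonzero cardinality.\<close>
      then have "card S \<noteq> 0" using finA by (auto dest: finite_subset)
      moreover have "card S < 2" using S by auto
      ultimately have "card S = 1" by linarith
      then obtain m where "S = {m}" by (auto simp: card_1_singleton_iff)
      then show "?t S = 0" using S A by (simp add: theta_singleton subset_iff)
    qed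
  qed (use finA in auto)
  also have "\<dots> = (\<Prod>m\<in>A. u m) + (\<Sum>S | S \<subseteq> A \<and> card S \<ge> 2. ?t S)"
    using finA by (simp add: theta_empty)
  finally show ?thesis
    using prob_select_var_le[OF A] by simp
qed

text \<open>For a single index no subset has two elements, so the correction sum is empty and the
  cdf at \<open>x\<close> is \<open>x\<close>.\<close>

lemma select_var_uniform01:
  assumes m: "m \<in> J"
  shows "uniform01 M (select_var I V m)"
proof (rule uniform01_if_cdf)
  show "prob {\<omega> \<in> space M. select_var I V m \<omega> \<le> x} = x" if "x \<in> {0..1}" for x
  proof -
    have "\<not> 2 \<le> card S" if "S \<subseteq> {m}" for S
      using card_mono[OF _ that] by simp
    then have *: "{S. S \<subseteq> {m} \<and> 2 \<le> card S} = {}" by blast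
    then show ?thesis
      using prob_select_var_le_formula[of "{m}" "\<lambda>_. x"] m that unfolding * by simp
  qed
qed (use m select_var_measurable prob_space_axioms in auto)

end

theorem theorem3:
  fixes M :: "'w measure"
    and d :: nat
    and I :: "nat \<Rightarrow> 'w \<Rightarrow> nat"
    and p :: "nat \<Rightarrow> real"
    and F :: "nat \<Rightarrow> nat \<Rightarrow> real \<Rightarrow> real"
    and V :: "nat \<Rightarrow> nat \<Rightarrow> 'w \<Rightarrow> real"
  assumes "prob_space M"
    and "d \<ge> 2"
    and "\<And>m. m \<in> {1..d} \<Longrightarrow> I m \<in> measurable M (count_space {0, 1})"
    and "\<And>m. m \<in> {1..d} \<Longrightarrow> 0 < p m \<and> p m < 1"
    and "\<And>m. m \<in> {1..d} \<Longrightarrow> measure M {\<omega> \<in> space M. I m \<omega> = 1} = p m"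
    and "\<And>m. m \<in> {1..d} \<Longrightarrow> calibrated_pair (p m) (F m 0) (F m 1)"
    and "\<And>m b. m \<in> {1..d} \<Longrightarrow> b \<in> {0, 1} \<Longrightarrow> has_cdf M (V m b) (F m b)"
    and "prob_space.indep_vars M (\<lambda>_. borel) (\<lambda>(m, b). V m b) ({1..d} \<times> {0, 1})"
    and "indep_rv M
           (\<Pi>\<^sub>M m\<in>{1..d}. count_space {0, 1}) (\<lambda>\<omega>. \<lambda>m\<in>{1..d}. I m \<omega>)
           (\<Pi>\<^sub>M i\<in>{1..d} \<times> {0, 1}. borel) (\<lambda>\<omega>. \<lambda>i\<in>{1..d} \<times> {0, 1}. V (fst i) (snd i) \<omega>)"
  shows "\<exists>C. is_copula d C \<and> has_copula M d (select_var I V) C \<and>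
           (\<forall>u\<in>unit_cube d.
              C u = (\<Prod>m\<in>{1..d}. u m) +
                (\<Sum>S | S \<subseteq> {1..d} \<and> card S \<ge> 2.
                   theta M p I S * (\<Prod>m\<in>{1..d} - S. u m) * (\<Prod>m\<in>S. g_fun p F m (u m))))"
proof -
  interpret calibrated_mixture M "{1..d}" I p F V
    using assms by (intro calibrated_mixture.intro calibrated_mixture_axioms.intro) auto
  \<comment> \<open>The witness is the joint cdf itself, cut to the cube as
    \<open>has_copula\<close> demands.\<close>
  let ?C = "restrict (joint_cdf M d (select_var I V)) (unit_cube d)"
  have "is_copula d ?C"
    using select_var_uniform01 prob_space_axioms by (intro is_copula_joint_cdf)
  moreover have "has_copula M d (select_var I V) ?C"
    using select_var_uniform01 by (simp add: has_copula_def)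
  moreover have "?C u = (\<Prod>m\<in>{1..d}. u m) +
                (\<Sum>S | S \<subseteq> {1..d} \<and> card S \<ge> 2.
                   theta M p I S * (\<Prod>m\<in>{1..d} - S. u m) * (\<Prod>m\<in>S. g_fun p F m (u m)))"
    if u: "u \<in> unit_cube d" for u
    \<comment> \<open>The bound on \<open>d\<close> makes \<open>{1..d}\<close> nonempty, as the
      expansion requires.\<close>
    using u \<open>d \<ge> 2\<close> prob_select_var_le_formula[of "{1..d}" u]
    by (auto simp: joint_cdf_def unit_cube_def PiE_iff)
  ultimately show ?thesis by blast
qed

end
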